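(* Let $C^*(\mathbb Z)_{(n)}$ be the Fejér--Riesz operator system. 1. The extreme rays in $(C^*(\mathbb Z)_{(n)})_+$ are given by the elements $a\in(C^*(\mathbb Z)_{(n)})_+$, $a=(a_k)$, for which the Laurent series $\sum_ka_kz^k$ has all its zeroes on the circle $S^1$. 2. The pure states of $C^*(\mathbb Z)_{(n)}$ are given by the functionals $a\mapsto\sum_ka_k\lambda^k$ for any $\lambda\in S^1$.
   Context: $n$ is a positive integer and $C^*(\mathbb Z)_{(n)}=\{a=(a_k)_{k\in\mathbb Z}:\mathrm{supp}(a)\subset(-n,n)\}$, an operator subsystem of the convolution $C^*$-algebra $C^*(\mathbb Z)\cong C(S^1)$, with adjoint $a^*_k=\overline{a_{-k}}$. An element $a$ is positive iff $\sum_ka_k\zeta^k\ge0$ for all $\zeta\in S^1$; $(C^*(\mathbb Z)_{(n)})_+$ is the cone of positive elements. The unit is $\delta_0$, corresponding to the constant function $1$. An element $a$ of a cone spans an extreme ray if $0\le b\le a$ implies that $b$ is a scalar multiple of $a$. A state is a positive linear functional of norm $1$ (equivalently, equal to $1$ on the unit); a pure state is an extreme point of the state space.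
   Formalization: Zeroes are those of z^(n-1)·∑a_k z^k, so 0 counts as a zero when a_{-(n-1)}=0: read on nonzero z the claim fails for n≥2, since δ_0 has no zeroes but dominates (2+z+1/z)/4. The zero element is not counted as spanning a ray. *)

theory Defs
  imports "HOL-Analysis.Analysis" "HOL-Computational_Algebra.Polynomial"
begin

definition fejer_riesz :: "nat \<Rightarrow> (int \<Rightarrow> complex) set" where
  "fejer_riesz n = {a. \<forall>k. a k \<noteq> 0 \<longrightarrow> - int n < k \<and> k < int n}"

definition laurent :: "nat \<Rightarrow> (int \<Rightarrow> complex) \<Rightarrow> complex \<Rightarrow> complex" where
  "laurent n a z = (\<Sum>k\<in>{- int n<..<int n}. a k * z powi k)"

definition fr_unit :: "int \<Rightarrow> complex" where
  "fr_unit = (\<lambda>k. if k = 0 then 1 else 0)"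

definition fr_cone :: "nat \<Rightarrow> (int \<Rightarrow> complex) set" where
  "fr_cone n = {a \<in> fejer_riesz n. \<forall>\<zeta>\<in>sphere 0 1. laurent n a \<zeta> \<in> \<real>\<^sub>\<ge>\<^sub>0}"

text \<open>The zero element satisfies the domination condition trivially but spans no ray, so it is
  excluded.\<close>

definition spans_extreme_ray :: "nat \<Rightarrow> (int \<Rightarrow> complex) \<Rightarrow> bool" where
  "spans_extreme_ray n a \<longleftrightarrow>
     a \<in> fr_cone n \<and> a \<noteq> (\<lambda>k. 0) \<and>
     (\<forall>b\<in>fr_cone n. (\<lambda>k. a k - b k) \<in> fr_cone n \<longrightarrow> (\<exists>c. b = (\<lambda>k. c * a k)))"

text \<open>The zeroes of \<open>a\<close>, as an element of the system of order \<open>n\<close>, are those of the polynomial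
  \<open>z^(n-1) * (\<Sum>k. a k * z^k)\<close> of formal degree \<open>2 * n - 2\<close>. On nonzero \<open>z\<close> these are the zeroes of
  the Laurent polynomial itself; \<open>0\<close> is a zero iff \<open>a (1 - n) = 0\<close>. For positive \<open>a\<close> one has
  \<open>a (- k) = cnj (a k)\<close>, so this happens iff the degree drops below \<open>2 * n - 2\<close>, that is, iff there
  is also a zero at infinity.

  The point \<open>0\<close> cannot be disregarded: for \<open>n \<ge> 2\<close> the unit has no zeroes in the punctured plane,
  but it is not extreme, since it dominates the positive element \<open>(2 + z + 1/z) / 4\<close>.\<close>

definition laurent_numerator :: "nat \<Rightarrow> (int \<Rightarrow> complex) \<Rightarrow> complex poly" where
  "laurent_numerator n a = (\<Sum>j\<le>2 * n - 2. monom (a (int j - (int n - 1))) j)"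

definition laurent_zeroes :: "nat \<Rightarrow> (int \<Rightarrow> complex) \<Rightarrow> complex set" where
  "laurent_zeroes n a = {z. poly (laurent_numerator n a) z = 0}"

lemma poly_laurent_numerator:
  assumes "0 < n" and "z \<noteq> 0"
  shows "poly (laurent_numerator n a) z = z ^ (n - 1) * laurent n a z"
proof -
  have bij: "bij_betw (\<lambda>j. int j - (int n - 1)) {..2 * n - 2} {- int n<..<int n}"
    by (rule bij_betw_byWitness[where f' = "\<lambda>k. nat (k + (int n - 1))"])
      (use assms(1) in \<open>auto simp: image_subset_iff\<close>)
  have pow: "z ^ (n - 1) * z powi (int j - (int n - 1)) = z ^ j" for j
  proof -
    have "z ^ (n - 1) * z powi (int j - (int n - 1))
        = z powi (int (n - 1) + (int j - (int n - 1)))"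
      using assms(2) by (simp only: power_int_add power_int_of_nat simp_thms)
    also have "int (n - 1) + (int j - (int n - 1)) = int j"
      using assms(1) by linarith
    finally show ?thesis by (simp only: power_int_of_nat)
  qed
  have "z ^ (n - 1) * laurent n a z
      = z ^ (n - 1) * (\<Sum>j\<le>2 * n - 2. a (int j - (int n - 1)) * z powi (int j - (int n - 1)))"
    unfolding laurent_def by (simp add: sum.reindex_bij_betw[OF bij, symmetric])
  also have "\<dots> = (\<Sum>j\<le>2 * n - 2. a (int j - (int n - 1)) * z ^ j)"
    unfolding sum_distrib_left
  proof (intro sum.cong refl)
    fix j
    show "z ^ (n - 1) * (a (int j - (int n - 1)) * z powi (int j - (int n - 1)))
        = a (int j - (int n - 1)) * z ^ j"
      unfolding pow[of j, symmetric] by (rule mult.left_commute)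
  qed
  finally show ?thesis
    by (simp add: laurent_numerator_def poly_sum poly_monom)
qed

text \<open>Functionals on the system are extensional (\<open>undefined\<close> off the system), so that equality of
  functionals is equality of functions. A positive functional attains its norm at the unit, so the
  normalisation \<open>\<phi> fr_unit = 1\<close> says that the norm is 1.\<close>

definition fr_states :: "nat \<Rightarrow> ((int \<Rightarrow> complex) \<Rightarrow> complex) set" where
  "fr_states n = {\<phi> \<in> extensional (fejer_riesz n).
     (\<forall>a\<in>fejer_riesz n. \<forall>b\<in>fejer_riesz n. \<phi> (\<lambda>k. a k + b k) = \<phi> a + \<phi> b) \<and>
     (\<forall>a\<in>fejer_riesz n. \<forall>c. \<phi> (\<lambda>k. c * a k) = c * \<phi> a) \<and>
     (\<forall>a\<in>fr_cone n. \<phi> a \<in> \<real>\<^sub>\<ge>\<^sub>0) \<and>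
     \<phi> fr_unit = 1}"

definition fr_pure_states :: "nat \<Rightarrow> ((int \<Rightarrow> complex) \<Rightarrow> complex) set" where
  "fr_pure_states n = {\<phi> \<in> fr_states n.
     \<forall>\<psi>\<in>fr_states n. \<forall>\<theta>\<in>fr_states n. \<forall>t::real.
       0 < t \<and> t < 1 \<and>
       \<phi> = (\<lambda>a\<in>fejer_riesz n. of_real (1 - t) * \<psi> a + of_real t * \<theta> a) \<longrightarrow>
       \<psi> = \<phi> \<and> \<theta> = \<phi>}"

end

theory Submission
  imports Defs "HOL-Computational_Algebra.Fundamental_Theorem_Algebra"
begin

text \<open>Multiplying by \<open>\<zeta>^N\<close>, with \<open>N = n - 1\<close>, turns a positive element into a self-reciprocal polynomial
  \<open>p\<close> of formal degree \<open>2 N\<close>. A root \<open>w\<close> off the circle comes with the root \<open>1 / cnj w\<close>, and a root on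
  the circle is a minimum of a nonnegative function, hence double. So \<open>a = \<bar>\<zeta> - w\<bar>\<^sup>2 b\<close> with \<open>b\<close> positive
  of lower order. If \<open>w\<close> is off the circle, \<open>a\<close> dominates a multiple of \<open>\<bar>\<zeta> - u\<bar>\<^sup>2 b\<close> and is not extreme;
  if all roots are on the circle, everything below \<open>a\<close> has the same factors and is a multiple of \<open>a\<close>.
  Taking all factors out gives the Fejer-Riesz factorization \<open>a = \<bar>r\<bar>\<^sup>2\<close>.

  A state \<open>\<phi>\<close> therefore amounts to the positive semidefinite Toeplitz form \<open>B s r = \<phi>(s cnj r)\<close> on
  polynomials of degree at most \<open>N\<close>. If a non-null \<open>r\<close> is orthogonal to all multiples of \<open>z - w\<close>, then
  \<open>B s r\<close> is a nonzero multiple of \<open>s(w)\<close>, and by Cauchy-Schwarz \<open>\<phi>\<close> dominates a positive multiple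
  of the evaluation at \<open>w\<close>; a pure \<open>\<phi>\<close> then equals it. For nondegenerate \<open>B\<close>, such an \<open>r\<close> is found by
  projecting \<open>1\<close>, with \<open>w = 1\<close>; otherwise \<open>r\<close> is a null vector of least degree divided by \<open>z - w\<close>,
  for a root \<open>w\<close> of it.\<close>

subsection \<open>Polynomials that are positive on the circle\<close>

lemma islimpt_unit_circle:
  fixes z :: complex
  assumes "z \<in> sphere 0 1"
  shows "z islimpt sphere 0 1"
proof (rule connected_imp_perfect[OF _ assms])
  show "connected (sphere (0::complex) 1)"
    by (simp add: connected_sphere)
  have "1 \<in> sphere (0::complex) 1" "-1 \<in> sphere (0::complex) 1" "(1::complex) \<noteq> - 1" by auto
  then show "sphere (0::complex) 1 \<noteq> {a}" for a
    by (metis singletonD)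
qed

lemma infinite_unit_circle: "infinite (sphere (0::complex) 1)"
  using islimpt_unit_circle[of 1] islimpt_finite by fastforce

text \<open>The circle minus one point is dense in the circle, so continuity carries a closed
  condition over to that point. This allows division by \<open>norm (\<zeta> - w)\<close> at its
  zero.\<close>

lemma circle_closed_property:
  fixes f :: "complex \<Rightarrow> complex"
  assumes "continuous_on UNIV f" "closed C"
    and "\<And>\<zeta>. \<zeta> \<in> sphere 0 1 \<Longrightarrow> \<zeta> \<noteq> w \<Longrightarrow> f \<zeta> \<in> C"
    and "\<zeta> \<in> sphere 0 1"
  shows "f \<zeta> \<in> C"
proof (cases "\<zeta> = w")
  case True
  have "closed (f -` C)"
    using assms(1,2) by (rule closed_vimage[rotated])
  moreover have "\<zeta> islimpt f -` C"
  proof -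
    have "\<zeta> islimpt sphere 0 1 - {w}"
      using islimpt_unit_circle[OF assms(4)] True
      by (auto simp: islimpt_approachable) 
    then show ?thesis
      by (rule islimpt_subset) (use assms(3) in auto)
  qed
  ultimately show ?thesis
    using closed_limpt by fastforce
qed (use assms in auto)

lemma poly_eqI_circle:
  fixes p q :: "complex poly"
  assumes "\<And>\<zeta>. \<zeta> \<in> sphere 0 1 \<Longrightarrow> poly p \<zeta> = poly q \<zeta>"
  shows "p = q"
proof (rule ccontr)
  assume "p \<noteq> q"
  then have "finite {z. poly (p - q) z = 0}" by (intro poly_roots_finite) simp
  moreover have "sphere 0 1 \<subseteq> {z. poly (p - q) z = 0}" using assms by auto
  ultimately show False using infinite_unit_circle finite_subset by blast
qed

lemma circle_mult_cnj:
  assumes "\<zeta> \<in> sphere (0::complex) 1"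
  shows "\<zeta> * cnj \<zeta> = 1" "cnj \<zeta> * \<zeta> = 1" "\<zeta> \<noteq> 0" "inverse \<zeta> = cnj \<zeta>"
proof -
  show 1: "\<zeta> * cnj \<zeta> = 1"
    using assms complex_norm_square[of \<zeta>] by simp
  then show "cnj \<zeta> * \<zeta> = 1" by (simp add: mult.commute)
  show "\<zeta> \<noteq> 0" using 1 by auto
  show "inverse \<zeta> = cnj \<zeta>" using 1 by (rule inverse_unique)
qed

lemma norm_eq_1_if_mult_cnj:
  assumes "w * cnj w = 1"
  shows "norm w = 1"
proof -
  have "(norm w)\<^sup>2 = 1"
    using assms complex_norm_square[of w] by (metis of_real_eq_1_iff)
  then show ?thesis using norm_ge_zero[of w] by (simp add: power2_eq_1_iff)
qed

section \<open>Nonnegative trigonometric polynomials and their root pairs\<close>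

definition pos_poly :: "nat \<Rightarrow> complex poly set" where
  "pos_poly N = {p. degree p \<le> 2 * N \<and>
     (\<forall>\<zeta>\<in>sphere 0 1. cnj \<zeta> ^ N * poly p \<zeta> \<in> \<real>\<^sub>\<ge>\<^sub>0)}"

text \<open>On the circle, \<open>circ_poly w\<close> is \<open>\<zeta>\<close> times \<open>\<bar>\<zeta> - w\<bar>\<^sup>2\<close>.\<close>

definition circ_poly :: "complex \<Rightarrow> complex poly" where
  "circ_poly w = [:- w, 1:] * [:1, - cnj w:]"

lemma poly_circ_poly:
  assumes "\<zeta> \<in> sphere 0 1"
  shows "cnj \<zeta> * poly (circ_poly w) \<zeta> = of_real ((norm (\<zeta> - w))\<^sup>2)"
proof -
  have "cnj \<zeta> * poly (circ_poly w) \<zeta> = (\<zeta> - w) * (cnj \<zeta> - (cnj \<zeta> * \<zeta>) * cnj w)"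
    by (simp add: circ_poly_def algebra_simps)
  also have "\<dots> = (\<zeta> - w) * cnj (\<zeta> - w)"
    using circle_mult_cnj[OF assms] by simp
  finally show ?thesis by (simp only: complex_norm_square)
qed

lemma circ_poly_nonzero [simp]: "circ_poly w \<noteq> 0"
  unfolding circ_poly_def by (intro no_zero_divisors) auto

lemma degree_circ_poly_le: "degree (circ_poly w) \<le> 2"
  unfolding circ_poly_def by (rule order.trans[OF degree_mult_le]) auto

lemma degree_circ_poly_mult_le: "degree q \<le> 2 * M \<Longrightarrow> degree (circ_poly w * q) \<le> 2 * Suc M"
  using degree_mult_le[of "circ_poly w" q] degree_circ_poly_le[of w] by simp

lemma poly_circ_poly_mult:
  assumes "\<zeta> \<in> sphere 0 1"
  shows "cnj \<zeta> ^ Suc M * poly (circ_poly w * q) \<zeta>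
           = of_real ((norm (\<zeta> - w))\<^sup>2) * (cnj \<zeta> ^ M * poly q \<zeta>)"
proof -
  have "cnj \<zeta> ^ Suc M * poly (circ_poly w * q) \<zeta>
      = (cnj \<zeta> * poly (circ_poly w) \<zeta>) * (cnj \<zeta> ^ M * poly q \<zeta>)" by simp
  then show ?thesis by (simp only: poly_circ_poly[OF assms])
qed

lemma nonneg_Reals_of_real_mult_cancel:
  fixes z :: complex
  assumes "of_real x * z \<in> \<real>\<^sub>\<ge>\<^sub>0" "x > 0"
  shows "z \<in> \<real>\<^sub>\<ge>\<^sub>0"
  using assms by (simp add: complex_nonneg_Reals_iff zero_le_mult_iff)

text \<open>Away from \<open>w\<close> a positive factor is divided out; the point \<open>w\<close>
  itself, if it lies on the circle, is reached by closedness.\<close>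

lemma pos_poly_circ_cancel:
  assumes "circ_poly w * q \<in> pos_poly (Suc M)" "degree q \<le> 2 * M"
  shows "q \<in> pos_poly M"
proof -
  have "cnj \<zeta> ^ M * poly q \<zeta> \<in> \<real>\<^sub>\<ge>\<^sub>0" if "\<zeta> \<in> sphere 0 1" for \<zeta>
  proof (rule circle_closed_property[where w = w, OF _ _ _ that])
    show "continuous_on UNIV (\<lambda>\<zeta>. cnj \<zeta> ^ M * poly q \<zeta>)"
      by (intro continuous_intros)
    fix \<zeta> assume \<zeta>: "\<zeta> \<in> sphere (0::complex) 1" "\<zeta> \<noteq> w"
    have "cnj \<zeta> ^ Suc M * poly (circ_poly w * q) \<zeta> \<in> \<real>\<^sub>\<ge>\<^sub>0"
      using assms(1) \<zeta>(1) by (simp only: pos_poly_def mem_Collect_eq)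
    then show "cnj \<zeta> ^ M * poly q \<zeta> \<in> \<real>\<^sub>\<ge>\<^sub>0"
      unfolding poly_circ_poly_mult[OF \<zeta>(1)]
      by (rule nonneg_Reals_of_real_mult_cancel) (use \<zeta>(2) in simp)
  qed auto
  then show ?thesis using assms(2) by (simp add: pos_poly_def)
qed

lemma poly_sum_le_degree:
  fixes p :: "'a::comm_semiring_1 poly"
  assumes "degree p \<le> N"
  shows "poly p x = (\<Sum>i\<le>N. coeff p i * x ^ i)"
  unfolding poly_altdef
  by (rule sum.mono_neutral_left) (use assms in \<open>auto simp: coeff_eq_0\<close>)

text \<open>The left side evaluates the conjugate reciprocal of \<open>p\<close> for the formal
  degree \<open>M\<close>, the operation that exchanges \<open>w\<close> and
  \<open>1 / cnj w\<close> as roots.\<close>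

lemma sum_cnj_coeff_rev:
  assumes "degree p \<le> M" "z \<noteq> 0"
  shows "(\<Sum>j\<le>M. cnj (coeff p (M - j)) * z ^ j) = z ^ M * cnj (poly p (inverse (cnj z)))"
proof -
  have "(\<Sum>j\<le>M. cnj (coeff p (M - j)) * z ^ j) = (\<Sum>j\<le>M. cnj (coeff p j) * z ^ (M - j))"
    by (rule sum.reindex_bij_witness[of _ "\<lambda>j. M - j" "\<lambda>j. M - j"]) auto
  also have "\<dots> = (\<Sum>j\<le>M. z ^ M * cnj (coeff p j * inverse (cnj z) ^ j))"
    using assms(2) by (intro sum.cong refl) (simp add: power_diff field_simps)
  also have "\<dots> = z ^ M * cnj (poly p (inverse (cnj z)))"
    by (simp add: sum_distrib_left poly_sum_le_degree[OF assms(1)])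
  finally show ?thesis .
qed

text \<open>A nonnegative value equals its conjugate, so \<open>p\<close> agrees with its conjugate
  reciprocal on the circle, which has enough points to force equality of polynomials.\<close>

lemma pos_poly_reflect:
  assumes "p \<in> pos_poly N"
  shows "p = (\<Sum>j\<le>2 * N. monom (cnj (coeff p (2 * N - j))) j)" (is "p = ?q")
proof (rule poly_eqI_circle)
  fix \<zeta> :: complex assume \<zeta>: "\<zeta> \<in> sphere 0 1"
  have "inverse (cnj \<zeta>) = \<zeta>"
    using circle_mult_cnj[OF \<zeta>] by (intro inverse_unique) auto
  then have "poly ?q \<zeta> = \<zeta> ^ (2 * N) * cnj (poly p \<zeta>)"
    using assms sum_cnj_coeff_rev[of p "2 * N" \<zeta>] circle_mult_cnj(3)[OF \<zeta>]
    by (simp add: poly_sum poly_monom pos_poly_def)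
  also have "\<dots> = \<zeta> ^ N * cnj (cnj \<zeta> ^ N * poly p \<zeta>)"
    by (simp add: mult_2 power_add)
  also have "cnj (cnj \<zeta> ^ N * poly p \<zeta>) = cnj \<zeta> ^ N * poly p \<zeta>"
    using assms \<zeta> unfolding pos_poly_def
    by (metis (mono_tags, lifting) mem_Collect_eq Reals_cnj_iff nonneg_Reals_subset_Reals subsetD)
  also have "\<zeta> ^ N * (cnj \<zeta> ^ N * poly p \<zeta>) = poly p \<zeta>"
    using circle_mult_cnj[OF \<zeta>] by (simp add: power_mult_distrib[symmetric] mult.assoc[symmetric])
  finally show "poly p \<zeta> = poly ?q \<zeta>" by simp
qed

lemma pos_poly_coeff_0:
  assumes "p \<in> pos_poly N"
  shows "coeff p 0 = cnj (coeff p (2 * N))"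
  by (subst pos_poly_reflect[OF assms]) (simp add: coeff_sum)

lemma pos_poly_conjugate_root:
  assumes "p \<in> pos_poly N" "poly p w = 0" "w \<noteq> 0"
  shows "poly p (inverse (cnj w)) = 0"
proof -
  have "poly p (inverse (cnj w))
      = (\<Sum>j\<le>2 * N. cnj (coeff p (2 * N - j)) * inverse (cnj w) ^ j)"
    by (subst pos_poly_reflect[OF assms(1)]) (simp add: poly_sum poly_monom)
  then show ?thesis
    using assms sum_cnj_coeff_rev[of p "2 * N" "inverse (cnj w)"] by (simp add: pos_poly_def)
qed

text \<open>A root on the circle is a minimum of the nonnegative function \<open>e^(-iNt) p(e^(it))\<close>.\<close>

lemma pos_poly_pderiv_root:
  assumes "p \<in> pos_poly N" "poly p u = 0" "u \<in> sphere 0 1"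
  shows "poly (pderiv p) u = 0"
proof -
  define G where "G = (\<lambda>z. exp (- (of_nat N * \<i> * z)) * poly p (exp (\<i> * z)))"
  define t0 where "t0 = Arg u"
  have t0: "exp (\<i> * of_real t0) = u"
    using assms(3) complex_norm_eq_1_exp_eq by (simp add: t0_def)
  define D where "D = exp (- (of_nat N * \<i> * of_real t0)) * (poly (pderiv p) u * (u * \<i>))"
  have nonneg: "G (of_real t) \<in> \<real>\<^sub>\<ge>\<^sub>0" for t
  proof -
    have "cnj (exp (\<i> * of_real t)) ^ N = exp (- (of_nat N * \<i> * of_real t))"
      by (simp add: exp_cnj exp_of_nat_mult[symmetric] mult.assoc)
    moreover have "exp (\<i> * of_real t) \<in> sphere 0 1" by simp
    ultimately show ?thesis
      using assms(1) unfolding pos_poly_def G_def by (metis (mono_tags, lifting) mem_Collect_eq)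
  qed
  have "(G has_field_derivative D) (at (of_real t0))"
    unfolding G_def D_def
    by (rule derivative_eq_intros poly_DERIV[THEN DERIV_chain2] refl)+ (simp add: t0 assms(2))
  then have G': "((\<lambda>t. G (of_real t)) has_vector_derivative D) (at t0)"
    by (rule has_vector_derivative_real_field)
  have Re0: "Re (G (of_real t0)) = 0" by (simp add: G_def t0 assms(2))
  have Re_nonneg: "0 \<le> Re (G (of_real t))" and Im: "Im (G (of_real t)) = 0" for t
    using nonneg[of t] by (simp_all add: complex_nonneg_Reals_iff)
  \<comment> \<open>Along the real line \<open>G\<close> is real and nonnegative and vanishes at
    \<open>t0\<close>: the minimum kills the real part of the derivative, the constant
    \<open>Im G\<close> the imaginary part.\<close>
  have "Re D = 0"
    by (rule DERIV_local_min[OF has_field_derivative_Re[OF G'], of 1])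
      (use Re_nonneg Re0 in auto)
  moreover have "Im D = 0"
    using has_field_derivative_Im[OF G'] Im by (simp add: DERIV_unique[OF _ DERIV_const])
  ultimately have "D = 0" by (simp add: complex_eq_iff)
  then show ?thesis
    using circle_mult_cnj(3)[OF assms(3)] by (simp add: D_def)
qed

text \<open>Roots pair up as \<open>w\<close> and \<open>1 / cnj w\<close>: for \<open>w = 0\<close>
  the partner sits at infinity and lowers the degree, on the circle the two merge into a double
  root.\<close>

lemma pos_poly_factor:
  assumes p: "p \<in> pos_poly N" "p \<noteq> 0" and w: "poly p w = 0"
  shows "\<exists>q M. N = Suc M \<and> p = circ_poly w * q \<and> q \<in> pos_poly M"
proof -
  have deg: "degree p \<le> 2 * N" using p(1) by (simp add: pos_poly_def)
  obtain q where q: "p = [:- w, 1:] * q"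
    using w by (auto simp: poly_eq_0_iff_dvd)
  have "q \<noteq> 0" using q p(2) by auto
  have deg_q: "degree p = Suc (degree q)"
    unfolding q using \<open>q \<noteq> 0\<close> by (subst degree_mult_eq) auto
  \<comment> \<open>The bound is against the formal degree: for \<open>w = 0\<close> the factor is
    only \<open>z\<close>, and the second degree is lost with the top coefficient.\<close>
  have "\<exists>r. p = circ_poly w * r \<and> degree r + 2 \<le> 2 * N"
  proof (cases "w = 0")
    case True
    then have "coeff p (2 * N) = 0"
      using pos_poly_coeff_0[OF p(1)] w by (simp add: poly_0_coeff_0)
    then have "degree p \<noteq> 2 * N" using p(2) leading_coeff_neq_0 by fastforce
    then show ?thesis
      using deg deg_q q True by (intro exI[of _ q]) (auto simp: circ_poly_def)
  next
    case False
    define v where "v = inverse (cnj w)"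
    have "poly q v = 0"
    proof (cases "v = w")
      case True
      then have "w * cnj w = 1" using False by (simp add: v_def field_simps)
      then have "w \<in> sphere 0 1"
        by (simp add: norm_eq_1_if_mult_cnj)
      then have "poly (pderiv p) w = 0"
        by (rule pos_poly_pderiv_root[OF p(1) w])
      moreover have "poly (pderiv p) w = poly q w"
        unfolding q pderiv_mult poly_add poly_mult by (simp add: pderiv_pCons)
      ultimately show ?thesis using True by metis
    next
      case ne: False
      have "poly p v = 0"
        using pos_poly_conjugate_root[OF p(1) w False] by (simp add: v_def)
      then show ?thesis using ne by (simp add: q)
    qed
    then obtain r where r: "q = [:- v, 1:] * r"
      by (auto simp: poly_eq_0_iff_dvd)
    have "r \<noteq> 0" using r \<open>q \<noteq> 0\<close> by auto
    have "degree q = Suc (degree r)"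
      unfolding r using \<open>r \<noteq> 0\<close> by (subst degree_mult_eq) auto
    moreover have "[:- v, 1:] = smult (- inverse (cnj w)) [:1, - cnj w:]"
      using False by (simp add: v_def)
    then have "p = circ_poly w * smult (- inverse (cnj w)) r"
      by (simp only: q r circ_poly_def mult_smult_left mult_smult_right mult.assoc)
    ultimately show ?thesis
      using deg deg_q False by (intro exI[of _ "smult (- inverse (cnj w)) r"]) auto
  qed
  then obtain r where r: "p = circ_poly w * r" "degree r + 2 \<le> 2 * N" by auto
  then obtain M where M: "N = Suc M" by (cases N) auto
  have "r \<in> pos_poly M"
    by (rule pos_poly_circ_cancel[of w]) (use p(1) r M in auto)
  then show ?thesis using r M by auto
qed

text \<open>Either 0 is a root, or the formal degree is attained and the fundamental theorem of
  algebra applies.\<close>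

lemma pos_poly_root_exists:
  assumes "p \<in> pos_poly (Suc N)"
  shows "\<exists>w. poly p w = 0"
proof (cases "coeff p 0 = 0")
  case True
  then show ?thesis by (auto simp: poly_0_coeff_0 intro!: exI[of _ 0])
next
  case False
  then have "coeff p (2 * Suc N) \<noteq> 0"
    using pos_poly_coeff_0[OF assms] by auto
  then have "2 * Suc N \<le> degree p" by (rule le_degree)
  then show ?thesis
    by (intro fundamental_theorem_of_algebra) (simp add: constant_degree)
qed

section \<open>Domination and the Fejer-Riesz factorization\<close>

lemma pos_poly_dominated_root:
  assumes "q \<in> pos_poly N" "p - q \<in> pos_poly N" "poly p u = 0" "u \<in> sphere 0 1"
  shows "poly q u = 0"
proof -
  have "cnj u ^ N * poly q u \<in> \<real>\<^sub>\<ge>\<^sub>0" "- (cnj u ^ N * poly q u) \<in> \<real>\<^sub>\<ge>\<^sub>0"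
    using assms unfolding pos_poly_def by fastforce+
  then have "cnj u ^ N * poly q u = 0"
    by (auto simp: complex_nonneg_Reals_iff complex_eq_iff)
  then show ?thesis using circle_mult_cnj(3)[OF assms(4)] by simp
qed

text \<open>Induction on \<open>N\<close>: at a root of \<open>p\<close> on the circle,
  \<open>q\<close> is squeezed to 0 as well, so the same factor cancels from \<open>p\<close>,
  \<open>q\<close> and \<open>p - q\<close>, until constants remain.\<close>

lemma pos_poly_dominated_scalar:
  assumes "p \<in> pos_poly N" "p \<noteq> 0" "{z. poly p z = 0} \<subseteq> sphere 0 1"
    and "q \<in> pos_poly N" "p - q \<in> pos_poly N"
  shows "\<exists>c. q = smult c p"
  using assms
proof (induction N arbitrary: p q)
  case 0
  then obtain c d where "p = [:c:]" "q = [:d:]" "c \<noteq> 0"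
    by (auto simp: pos_poly_def elim!: degree_eq_zeroE)
  then show ?case by (intro exI[of _ "d / c"]) auto
next
  case (Suc N)
  show ?case
  proof (cases "q = 0")
    case True
    then show ?thesis by (intro exI[of _ 0]) auto
  next
    case False
    obtain u where u: "poly p u = 0"
      using pos_poly_root_exists[OF Suc.prems(1)] by auto
    then have "u \<in> sphere 0 1" using Suc.prems(3) by auto
    then have "poly q u = 0"
      using pos_poly_dominated_root[OF Suc.prems(4,5) u] by auto
    obtain p1 where p1: "p = circ_poly u * p1" "p1 \<in> pos_poly N"
      using pos_poly_factor[OF Suc.prems(1,2) u] by auto
    obtain q1 where q1: "q = circ_poly u * q1" "q1 \<in> pos_poly N"
      using pos_poly_factor[OF Suc.prems(4) False \<open>poly q u = 0\<close>] by auto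
    have "p1 - q1 \<in> pos_poly N"
    proof (rule pos_poly_circ_cancel)
      show "circ_poly u * (p1 - q1) \<in> pos_poly (Suc N)"
        using Suc.prems(5) by (simp add: p1 q1 right_diff_distrib)
      show "degree (p1 - q1) \<le> 2 * N"
        using p1(2) q1(2) by (intro degree_diff_le) (auto simp: pos_poly_def)
    qed
    then obtain c where "q1 = smult c p1"
      using Suc.IH[of p1 q1] p1 q1 Suc.prems(2,3) by auto
    then show ?thesis using p1 q1 by auto
  qed
qed

text \<open>Writing \<open>p\<close> as \<open>\<bar>\<zeta> - w\<bar>\<^sup>2 r\<close> with \<open>w\<close> off the circle, the first factor is bounded below on the
  circle and hence dominates \<open>e\<bar>\<zeta> - u\<bar>\<^sup>2\<close> for small \<open>e\<close> and any \<open>u\<close> on the circle.\<close>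

lemma pos_poly_root_off_circle:
  assumes "p \<in> pos_poly N" "p \<noteq> 0" "poly p w = 0" "w \<notin> sphere 0 1"
  shows "\<exists>q\<in>pos_poly N. p - q \<in> pos_poly N \<and> (\<nexists>c. q = smult c p)"
proof -
  obtain r M where r: "N = Suc M" "p = circ_poly w * r" "r \<in> pos_poly M"
    using pos_poly_factor[OF assms(1-3)] by auto
  have "r \<noteq> 0" using assms(2) r(2) by auto
  then have "finite {z. poly r z = 0}" by (rule poly_roots_finite)
  \<comment> \<open>The \<open>q\<close> below vanishes at \<open>u\<close> while \<open>p\<close>
    does not, so it cannot be a nonzero multiple of \<open>p\<close>.\<close>
  then obtain u where u: "u \<in> sphere 0 1" "poly r u \<noteq> 0"
    using infinite_unit_circle finite_subset[of "sphere 0 1" "{z. poly r z = 0}"] by blast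
  \<comment> \<open>On the circle \<open>norm (\<zeta> - w)\<close> is at least
    \<open>\<bar>1 - norm w\<bar>\<close>, and \<open>norm (\<zeta> - u)\<close> is at most
    2.\<close>
  define e where "e = ((1 - norm w) / 2)\<^sup>2"
  have "e > 0" using assms(4) by (auto simp: e_def)
  define q where "q = smult (of_real e) (circ_poly u * r)"
  have qdeg: "degree q \<le> 2 * N"
    using degree_circ_poly_mult_le[of r M u] r by (simp add: q_def pos_poly_def)
  have q_eq: "cnj \<zeta> ^ N * poly q \<zeta>
      = of_real (e * (norm (\<zeta> - u))\<^sup>2) * (cnj \<zeta> ^ M * poly r \<zeta>)" if "\<zeta> \<in> sphere 0 1" for \<zeta>
    using poly_circ_poly_mult[OF that, of M u r] by (simp add: q_def r(1) mult_ac)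
  have "q \<in> pos_poly N"
    using \<open>e > 0\<close> r(3) unfolding pos_poly_def
    by (auto simp: qdeg q_eq intro!: nonneg_Reals_mult_I simp del: of_real_mult)
  moreover have "p - q \<in> pos_poly N"
  proof -
    have "cnj \<zeta> ^ N * poly (p - q) \<zeta> \<in> \<real>\<^sub>\<ge>\<^sub>0" if \<zeta>: "\<zeta> \<in> sphere 0 1" for \<zeta>
    proof -
      have "norm (\<zeta> - u) \<le> 2"
        using norm_triangle_ineq4[of \<zeta> u] \<zeta> u(1) by simp
      then have "\<bar>(1 - norm w) / 2 * norm (\<zeta> - u)\<bar> \<le> \<bar>1 - norm w\<bar>"
        by (simp add: abs_mult mult_left_mono)
      also have "\<dots> \<le> norm (\<zeta> - w)"
        using norm_triangle_ineq3[of \<zeta> w] \<zeta> by simp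
      finally have "e * (norm (\<zeta> - u))\<^sup>2 \<le> (norm (\<zeta> - w))\<^sup>2"
        unfolding e_def power_mult_distrib[symmetric] abs_le_square_iff[symmetric] by simp
      then have "0 \<le> (norm (\<zeta> - w))\<^sup>2 - e * (norm (\<zeta> - u))\<^sup>2" by simp
      moreover have "cnj \<zeta> ^ N * poly (p - q) \<zeta>
          = of_real ((norm (\<zeta> - w))\<^sup>2 - e * (norm (\<zeta> - u))\<^sup>2) * (cnj \<zeta> ^ M * poly r \<zeta>)"
        using q_eq[OF \<zeta>] poly_circ_poly_mult[OF \<zeta>, of M w r]
        by (simp only: r(1,2) poly_diff right_diff_distrib left_diff_distrib of_real_diff)
      ultimately show ?thesis
        using r(3) \<zeta> by (auto simp: pos_poly_def intro!: nonneg_Reals_mult_I simp del: of_real_diff)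
    qed
    then show ?thesis
      using qdeg assms(1) by (auto simp: pos_poly_def intro: degree_diff_le)
  qed
  moreover have False if c: "q = smult c p" for c
  proof -
    have "poly (circ_poly u) u = 0" unfolding circ_poly_def poly_mult by simp
    then have "poly q u = 0" by (simp add: q_def)
    then have "c * (poly (circ_poly w) u * poly r u) = 0" using c r(2) by simp
    moreover have "poly (circ_poly w) u \<noteq> 0"
      using poly_circ_poly[OF u(1), of w] u(1) assms(4) by auto
    ultimately have "c = 0" using u(2) by simp
    then show False using c \<open>e > 0\<close> \<open>r \<noteq> 0\<close> by (simp add: q_def)
  qed
  ultimately show ?thesis by blast
qed

text \<open>The Fejer-Riesz theorem: each root pair that is split off contributes one factor
  \<open>z - w\<close> to \<open>r\<close>.\<close>

lemma pos_poly_eq_square: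
  assumes "p \<in> pos_poly N"
  shows "\<exists>r. degree r \<le> N \<and> (\<forall>\<zeta>\<in>sphere 0 1. cnj \<zeta> ^ N * poly p \<zeta> = of_real ((norm (poly r \<zeta>))\<^sup>2))"
  using assms
proof (induction N arbitrary: p)
  case 0
  then obtain c where c: "p = [:c:]" by (auto simp: pos_poly_def elim!: degree_eq_zeroE)
  have "(1::complex) \<in> sphere 0 1" by simp
  then have "c \<in> \<real>\<^sub>\<ge>\<^sub>0" using 0 c unfolding pos_poly_def by fastforce
  then obtain x where x: "c = of_real x" "x \<ge> 0" by (auto elim: nonneg_Reals_cases)
  show ?case by (intro exI[of _ "[:of_real (sqrt x):]"]) (simp add: c x flip: of_real_power)
next
  case (Suc N)
  show ?case
  proof (cases "p = 0")
    case True
    then show ?thesis by (intro exI[of _ 0]) auto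
  next
    case False
    obtain w where "poly p w = 0" using pos_poly_root_exists[OF Suc.prems] by auto
    then obtain q where q: "p = circ_poly w * q" "q \<in> pos_poly N"
      using pos_poly_factor[OF Suc.prems False] by auto
    obtain r where r: "degree r \<le> N"
      "\<forall>\<zeta>\<in>sphere 0 1. cnj \<zeta> ^ N * poly q \<zeta> = of_real ((norm (poly r \<zeta>))\<^sup>2)"
      using Suc.IH[OF q(2)] by auto
    have "degree ([:- w, 1:] * r) \<le> Suc N"
      using degree_mult_le[of "[:- w, 1:]" r] r(1) by simp
    moreover have "cnj \<zeta> ^ Suc N * poly p \<zeta> = of_real ((norm (poly ([:- w, 1:] * r) \<zeta>))\<^sup>2)"
      if "\<zeta> \<in> sphere 0 1" for \<zeta>
      using that r(2) unfolding q(1) poly_circ_poly_mult[OF that]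
      by (simp only: poly_mult norm_mult power_mult_distrib of_real_mult) simp
    ultimately show ?thesis by blast
  qed
qed

subsection \<open>Extreme rays\<close>

lemma laurent_numerator_coeff:
  "coeff (laurent_numerator (Suc N) a) j = (if j \<le> 2 * N then a (int j - int N) else 0)"
  by (auto simp: laurent_numerator_def coeff_sum)

lemma degree_laurent_numerator: "degree (laurent_numerator (Suc N) a) \<le> 2 * N"
  by (intro degree_le) (auto simp: laurent_numerator_coeff)

lemma laurent_eq_poly:
  assumes "\<zeta> \<in> sphere 0 1"
  shows "laurent (Suc N) a \<zeta> = cnj \<zeta> ^ N * poly (laurent_numerator (Suc N) a) \<zeta>"
  using poly_laurent_numerator[of "Suc N" \<zeta> a] circle_mult_cnj[OF assms]
  by (simp add: power_mult_distrib[symmetric] mult.assoc[symmetric])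

lemma fr_cone_iff:
  "a \<in> fr_cone (Suc N) \<longleftrightarrow> a \<in> fejer_riesz (Suc N) \<and> laurent_numerator (Suc N) a \<in> pos_poly N"
  by (auto simp: fr_cone_def pos_poly_def laurent_eq_poly degree_laurent_numerator)

lemma fejer_riesz_eq_0:
  "a \<in> fejer_riesz (Suc N) \<Longrightarrow> k < - int N \<or> int N < k \<Longrightarrow> a k = 0"
  by (force simp: fejer_riesz_def)

lemma laurent_numerator_inj:
  assumes "a \<in> fejer_riesz (Suc N)" "b \<in> fejer_riesz (Suc N)"
    and eq: "laurent_numerator (Suc N) a = laurent_numerator (Suc N) b"
  shows "a = b"
proof
  fix k
  show "a k = b k"
  proof (cases "k < - int N \<or> int N < k")
    case True
    then show ?thesis using assms(1,2) by (simp add: fejer_riesz_eq_0)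
  next
    case False
    then have "nat (k + int N) \<le> 2 * N" "int (nat (k + int N)) - int N = k" by auto
    then show ?thesis
      using arg_cong[OF eq, of "\<lambda>p. coeff p (nat (k + int N))"]
      by (simp add: laurent_numerator_coeff)
  qed
qed

lemma laurent_numerator_surj:
  assumes "degree p \<le> 2 * N"
  obtains a where "a \<in> fejer_riesz (Suc N)" "laurent_numerator (Suc N) a = p"
proof
  let ?a = "\<lambda>k. if - int N \<le> k \<and> k \<le> int N then coeff p (nat (k + int N)) else 0"
  show "?a \<in> fejer_riesz (Suc N)" by (auto simp: fejer_riesz_def)
  show "laurent_numerator (Suc N) ?a = p"
    using assms by (intro poly_eqI) (auto simp: laurent_numerator_coeff coeff_eq_0)
qed

lemma laurent_numerator_diff:
  "laurent_numerator (Suc N) (\<lambda>k. a k - b k)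
     = laurent_numerator (Suc N) a - laurent_numerator (Suc N) b"
  by (intro poly_eqI) (simp add: laurent_numerator_coeff)

lemma laurent_numerator_scale:
  "laurent_numerator (Suc N) (\<lambda>k. c * a k) = smult c (laurent_numerator (Suc N) a)"
  by (intro poly_eqI) (simp add: laurent_numerator_coeff)

lemma laurent_numerator_0: "laurent_numerator (Suc N) (\<lambda>k. 0) = 0"
  by (intro poly_eqI) (simp add: laurent_numerator_coeff)

lemma fejer_riesz_closed:
  assumes "a \<in> fejer_riesz n" "b \<in> fejer_riesz n"
  shows "(\<lambda>k. a k + b k) \<in> fejer_riesz n" "(\<lambda>k. a k - b k) \<in> fejer_riesz n"
    "(\<lambda>k. c * a k) \<in> fejer_riesz n" "(\<lambda>k. 0) \<in> fejer_riesz n"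
  using assms by (force simp: fejer_riesz_def)+

text \<open>\<open>laurent_numerator\<close> transports positivity, differences and scalar multiples
  to polynomials, where the two domination results decide extremality.\<close>

lemma spans_extreme_ray_iff:
  "spans_extreme_ray (Suc N) a \<longleftrightarrow>
     a \<in> fr_cone (Suc N) \<and> laurent_zeroes (Suc N) a \<subseteq> sphere 0 1"
proof (cases "a \<in> fr_cone (Suc N)")
  case True
  define p where "p = laurent_numerator (Suc N) a"
  have a: "a \<in> fejer_riesz (Suc N)" and p: "p \<in> pos_poly N"
    using True by (auto simp: fr_cone_iff p_def)
  have p0: "p = 0 \<longleftrightarrow> a = (\<lambda>k. 0)"
    unfolding p_def using laurent_numerator_inj[OF a fejer_riesz_closed(4)[OF a a]]
    by (auto simp: laurent_numerator_0)
  show ?thesis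
  proof
    assume ext: "spans_extreme_ray (Suc N) a"
    then have "p \<noteq> 0" using p0 by (auto simp: spans_extreme_ray_def)
    have "w \<in> sphere 0 1" if w: "poly p w = 0" for w
    proof (rule ccontr)
      assume "w \<notin> sphere 0 1"
      then obtain q where q: "q \<in> pos_poly N" "p - q \<in> pos_poly N" "\<nexists>c. q = smult c p"
        using pos_poly_root_off_circle[OF p \<open>p \<noteq> 0\<close> w] by blast
      have "degree q \<le> 2 * N" using q(1) by (simp add: pos_poly_def)
      then obtain b where b: "b \<in> fejer_riesz (Suc N)" "laurent_numerator (Suc N) b = q"
        by (rule laurent_numerator_surj)
      have "b \<in> fr_cone (Suc N)" "(\<lambda>k. a k - b k) \<in> fr_cone (Suc N)"
        using a b q by (simp_all add: fr_cone_iff laurent_numerator_diff fejer_riesz_closed p_def)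
      then obtain c where "b = (\<lambda>k. c * a k)"
        using ext by (auto simp: spans_extreme_ray_def)
      then show False
        using q(3) b(2) by (auto simp: laurent_numerator_scale p_def)
    qed
    then show "a \<in> fr_cone (Suc N) \<and> laurent_zeroes (Suc N) a \<subseteq> sphere 0 1"
      using True by (auto simp: laurent_zeroes_def p_def)
  next
    assume R: "a \<in> fr_cone (Suc N) \<and> laurent_zeroes (Suc N) a \<subseteq> sphere 0 1"
    then have sub: "{z. poly p z = 0} \<subseteq> sphere 0 1"
      by (simp add: laurent_zeroes_def p_def)
    \<comment> \<open>The zero polynomial would vanish at 0, off the circle; so the condition on the
      roots already makes \<open>a\<close> nonzero.\<close>
    have "0 \<notin> {z. poly p z = 0}" using sub by auto
    then have "p \<noteq> 0" by auto
    have "\<exists>c. b = (\<lambda>k. c * a k)"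
      if b: "b \<in> fr_cone (Suc N)" "(\<lambda>k. a k - b k) \<in> fr_cone (Suc N)" for b
    proof -
      obtain c where "laurent_numerator (Suc N) b = smult c p"
        using pos_poly_dominated_scalar[OF p \<open>p \<noteq> 0\<close> sub] b
        by (auto simp: fr_cone_iff laurent_numerator_diff p_def)
      then have "b = (\<lambda>k. c * a k)"
        using b(1) a by (intro laurent_numerator_inj[of _ N])
          (auto simp: fr_cone_iff fejer_riesz_closed laurent_numerator_scale p_def)
      then show ?thesis by auto
    qed
    then show "spans_extreme_ray (Suc N) a"
      using True \<open>p \<noteq> 0\<close> p0 by (auto simp: spans_extreme_ray_def)
  qed
qed (auto simp: spans_extreme_ray_def)

subsection \<open>Positive semidefinite Toeplitz forms\<close>

text \<open>If \<open>m k\<close> is the value of a functional at \<open>z^k\<close>, this is its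
  value at \<open>s cnj r\<close>, since \<open>cnj z = 1 / z\<close> on the circle. Coefficients
  beyond \<open>N\<close> are cut off.\<close>

definition toeplitz_form :: "nat \<Rightarrow> (int \<Rightarrow> complex) \<Rightarrow> complex poly \<Rightarrow> complex poly \<Rightarrow> complex" where
  "toeplitz_form N m s r = (\<Sum>i\<le>N. \<Sum>j\<le>N. coeff s i * cnj (coeff r j) * m (int i - int j))"

locale psd_toeplitz =
  fixes N :: nat and m :: "int \<Rightarrow> complex"
  assumes psd: "toeplitz_form N m r r \<in> \<real>\<^sub>\<ge>\<^sub>0"
    and m_0: "m 0 = 1"
begin

abbreviation B :: "complex poly \<Rightarrow> complex poly \<Rightarrow> complex" where
  "B \<equiv> toeplitz_form N m"

lemma B_linear:
  "B (s + s') r = B s r + B s' r" "B (s - s') r = B s r - B s' r" "B (smult c s) r = c * B s r"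
  "B 0 r = 0" "B s 0 = 0"
  "B s (r + r') = B s r + B s r'" "B s (r - r') = B s r - B s r'" "B s (smult c r) = cnj c * B s r"
  by (simp_all add: toeplitz_form_def sum.distrib sum_subtractf sum_distrib_left algebra_simps)

text \<open>Entries depend on \<open>i - j\<close> only, so multiplication by \<open>z\<close>
  preserves the form as long as no coefficient is pushed beyond \<open>N\<close>.\<close>

lemma B_shift:
  assumes "degree s < N" "degree r < N"
  shows "B (pCons 0 s) (pCons 0 r) = B s r"
proof -
  obtain M where M: "N = Suc M" using assms(1) by (cases N) auto
  have top: "coeff s (Suc M) = 0" "coeff r (Suc M) = 0"
    using assms M by (auto intro: coeff_eq_0)
  have "B (pCons 0 s) (pCons 0 r)
      = (\<Sum>i\<le>M. \<Sum>j\<le>M. coeff s i * cnj (coeff r j) * m (int i - int j))"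
    unfolding toeplitz_form_def M by (simp add: sum.atMost_Suc_shift del: sum.atMost_Suc)
  also have "\<dots> = B s r"
    unfolding toeplitz_form_def M by (simp add: top)
  finally show ?thesis .
qed

text \<open>Polarization: \<open>B f f\<close> is real at \<open>s + r\<close> and at
  \<open>s + \<i> r\<close>, which settles the imaginary and the real part in turn.\<close>

lemma B_hermitian: "B r s = cnj (B s r)"
proof -
  have real: "Im (B f f) = 0" for f
    using psd[of f] by (simp add: complex_nonneg_Reals_iff)
  have "Im (B s r) + Im (B r s) = 0"
    using real[of "s + r"] real[of s] real[of r] by (simp add: B_linear)
  moreover have "Re (B r s) - Re (B s r) = 0"
    using real[of "s + smult \<i> r"] real[of s] real[of r] by (simp add: B_linear)
  ultimately show ?thesis by (simp add: complex_eq_iff)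
qed

lemma B_cauchy_schwarz: "(norm (B s r))\<^sup>2 \<le> Re (B s s) * Re (B r r)"
proof -
  define a b c where "a = Re (B s s)" and "b = Re (B r r)" and "c = B s r"
  have B: "B s s = of_real a" "B r r = of_real b" "B r s = cnj c" "a \<ge> 0" "b \<ge> 0"
    using psd[of s] psd[of r] B_hermitian[of r s]
    by (auto simp: a_def b_def c_def complex_nonneg_Reals_iff complex_eq_iff)
  \<comment> \<open>Positivity at \<open>s - x c r\<close>. The best choice is
    \<open>x = 1 / b\<close>; for \<open>b = 0\<close> the bound is linear in \<open>x\<close> and
    fails for large \<open>x\<close> unless \<open>c = 0\<close>.\<close>
  have quad: "0 \<le> a - 2 * x * (norm c)\<^sup>2 + x\<^sup>2 * (norm c)\<^sup>2 * b" for x :: real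
  proof -
    have "B (s - smult (of_real x * c) r) (s - smult (of_real x * c) r)
        = of_real a - 2 * of_real x * (c * cnj c) + (of_real x)\<^sup>2 * (c * cnj c) * of_real b"
      by (simp add: B_linear B power2_eq_square algebra_simps c_def[symmetric])
    also have "\<dots> = of_real (a - 2 * x * (norm c)\<^sup>2 + x\<^sup>2 * (norm c)\<^sup>2 * b)"
      by (simp add: complex_norm_square[symmetric])
    finally show ?thesis
      using psd[of "s - smult (of_real x * c) r"] by (simp add: complex_nonneg_Reals_iff)
  qed
  have "(norm c)\<^sup>2 \<le> a * b"
  proof (cases "b = 0")
    case True
    have "c = 0"
    proof (rule ccontr)
      assume "c \<noteq> 0"
      then have "(a + 1) / (norm c)\<^sup>2 * (norm c)\<^sup>2 = a + 1" by simp
      then show False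
        using quad[of "(a + 1) / (norm c)\<^sup>2"] True B(4) \<open>c \<noteq> 0\<close> by simp
    qed
    then show ?thesis using B by simp
  next
    case False
    then have "b > 0" using B by simp
    have "0 \<le> a - (norm c)\<^sup>2 / b"
      using quad[of "1 / b"] \<open>b > 0\<close> by (simp add: field_simps power2_eq_square)
    then show ?thesis using \<open>b > 0\<close> by (simp add: field_simps)
  qed
  then show ?thesis by (simp add: a_def b_def c_def)
qed

lemma B_null: "B r r = 0 \<Longrightarrow> B s r = 0"
  using B_cauchy_schwarz[of s r] by simp

text \<open>Every \<open>s\<close> differs from the constant \<open>s(w)\<close> by a multiple of \<open>z - w\<close>, so \<open>B s r\<close> is a multiple
  of \<open>s(w)\<close>, and Cauchy-Schwarz bounds the evaluation at \<open>w\<close> by the form.\<close>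

lemma evaluation_dominated:
  assumes orth: "\<And>s. degree s < N \<Longrightarrow> B ([:- w, 1:] * s) r = 0"
    and r: "degree r \<le> N" "B r r \<noteq> 0"
  shows "\<exists>t>0. \<forall>s. degree s \<le> N \<longrightarrow> t * (norm (poly s w))\<^sup>2 \<le> Re (B s s)"
proof -
  define \<kappa> where "\<kappa> = B 1 r"
  have eval: "B s r = poly s w * \<kappa>" if "degree s \<le> N" for s
  proof -
    obtain q where q: "s - [:poly s w:] = [:- w, 1:] * q"
      by (metis dvdE poly_eq_0_iff_dvd poly_diff poly_pCons poly_0 mult_zero_right add_0_right diff_self)
    have "B ([:- w, 1:] * q) r = 0"
    proof (cases "q = 0")
      case False
      then have "Suc (degree q) = degree (s - [:poly s w:])"
        unfolding q by (subst degree_mult_eq) auto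
      also have "\<dots> \<le> N" using that by (intro degree_diff_le) auto
      finally show ?thesis by (intro orth) simp
    qed (simp add: B_linear)
    moreover have "s = smult (poly s w) 1 + [:- w, 1:] * q"
      using q by (simp add: algebra_simps one_pCons)
    ultimately show ?thesis
      by (metis B_linear(1,3) \<kappa>_def add_0_right)
  qed
  define b where "b = Re (B r r)"
  have "b > 0"
    using psd[of r] r(2) by (auto simp: b_def complex_nonneg_Reals_iff complex_eq_iff less_le)
  \<comment> \<open>Since \<open>B r r = poly r w * \<kappa>\<close>, a vanishing
    \<open>\<kappa>\<close> would make \<open>r\<close> null.\<close>
  have "\<kappa> \<noteq> 0" using eval[OF r(1)] r(2) by auto
  have "(norm \<kappa>)\<^sup>2 / b * (norm (poly s w))\<^sup>2 \<le> Re (B s s)" if "degree s \<le> N" for s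
    using B_cauchy_schwarz[of s r] \<open>b > 0\<close> eval[OF that]
    by (simp add: b_def[symmetric] norm_mult power_mult_distrib field_simps)
  then show ?thesis
    using \<open>b > 0\<close> \<open>\<kappa> \<noteq> 0\<close> by (intro exI[of _ "(norm \<kappa>)\<^sup>2 / b"]) auto
qed

text \<open>Gram-Schmidt for a possibly degenerate form: \<open>f\<close> is projected onto the
  multiples \<open>g s\<close> with \<open>s\<close> of degree below \<open>k\<close>. Vanishing
  coefficients express this so that \<open>k = 0\<close> leaves only \<open>s = 0\<close>;
  \<open>f\<close> is arbitrary because the induction also projects \<open>g z^k\<close>.\<close>

lemma projection_exists:
  "\<exists>s. (\<forall>i\<ge>k. coeff s i = 0) \<and>
     (\<forall>s'. (\<forall>i\<ge>k. coeff s' i = 0) \<longrightarrow> B (g * s') (f - g * s) = 0)"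
proof (induction k arbitrary: f)
  case 0
  have "s = 0" if "\<forall>i\<ge>0. coeff s i = 0" for s :: "complex poly"
    using that by (intro poly_eqI) auto
  then have "B (g * s') h = 0" if "\<forall>i\<ge>0. coeff s' i = 0" for s' h
    using that by (metis B_linear(4) mult_zero_right)
  then show ?case by (intro exI[of _ 0]) simp
next
  case (Suc k)
  obtain s where s: "\<forall>i\<ge>k. coeff s i = 0"
    "\<And>s'. \<forall>i\<ge>k. coeff s' i = 0 \<Longrightarrow> B (g * s') (f - g * s) = 0"
    using Suc by blast
  obtain u where u: "\<forall>i\<ge>k. coeff u i = 0"
    "\<And>s'. \<forall>i\<ge>k. coeff s' i = 0 \<Longrightarrow> B (g * s') (g * monom 1 k - g * u) = 0"
    using Suc by blast
  define e where "e = g * monom 1 k - g * u"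
  define c where "c = B (f - g * s) e / B e e"
  define v where "v = s + smult c (monom 1 k - u)"
  have f_v: "f - g * v = (f - g * s) - smult c e"
    by (simp add: v_def e_def algebra_simps smult_diff_right)
  \<comment> \<open>A null \<open>e\<close> is orthogonal to everything; otherwise \<open>c\<close>
    is the Fourier coefficient along \<open>e\<close>.\<close>
  have orth_e: "B e (f - g * v) = 0"
  proof (cases "B e e = 0")
    case True
    then show ?thesis using B_null B_hermitian by (metis complex_cnj_zero)
  next
    case False
    have "cnj (B e e) = B e e" using B_hermitian[of e e] by simp
    then have "B e (f - g * v) = B e (f - g * s) - cnj (B (f - g * s) e)"
      using False unfolding f_v by (simp add: B_linear c_def)
    then show ?thesis using B_hermitian[of e "f - g * s"] by simp
  qed
  show ?case
  proof (intro exI[of _ v] conjI allI impI)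
    show "coeff v i = 0" if "Suc k \<le> i" for i
      using that s(1) u(1) by (simp add: v_def)
    fix s' :: "complex poly" assume s': "\<forall>i\<ge>Suc k. coeff s' i = 0"
    define s'' where "s'' = s' - smult (coeff s' k) (monom 1 k - u)"
    have low: "\<forall>i\<ge>k. coeff s'' i = 0"
    proof (intro allI impI)
      fix i assume "k \<le> i"
      then show "coeff s'' i = 0"
        using s' u(1) by (cases "i = k") (auto simp: s''_def)
    qed
    have split: "g * s' = g * s'' + smult (coeff s' k) e"
      by (simp add: s''_def e_def algebra_simps smult_diff_right)
    have "B (g * s'') (f - g * v) = 0"
      using s(2)[OF low] u(2)[OF low, folded e_def] unfolding f_v B_linear(7,8) by simp
    then show "B (g * s') (f - g * v) = 0"
      unfolding split B_linear(1,3) using orth_e by simp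
  qed
qed

text \<open>For a null vector \<open>r = (z - w) r'\<close> of least degree, \<open>B (z r') r = 0 = B r' r\<close> forces
  \<open>\<bar>w\<bar> = 1\<close>, and \<open>r'\<close> is then orthogonal to all multiples of \<open>z - w\<close>.\<close>

lemma evaluation_dominated_degenerate:
  assumes "r0 \<noteq> 0" "degree r0 \<le> N" "B r0 r0 = 0"
  shows "\<exists>w\<in>sphere 0 1. \<exists>t>0. \<forall>s. degree s \<le> N \<longrightarrow> t * (norm (poly s w))\<^sup>2 \<le> Re (B s s)"
proof -
  define null where "null = (\<lambda>r. r \<noteq> 0 \<and> degree r \<le> N \<and> B r r = 0)"
  define r where "r = (ARG_MIN degree r. null r)"
  have "null r0" using assms by (simp add: null_def)
  then have "null r" and min: "null s \<Longrightarrow> degree r \<le> degree s" for s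
    unfolding r_def by (auto intro: arg_min_natI arg_min_nat_le)
  then have r: "r \<noteq> 0" "degree r \<le> N" "B r r = 0" by (auto simp: null_def)
  \<comment> \<open>A nonzero constant is not null, because \<open>m 0 = 1\<close>.\<close>
  have "degree r \<noteq> 0"
  proof
    assume "degree r = 0"
    then obtain c where c: "r = [:c:]" by (elim degree_eq_zeroE)
    have "B 1 1 = 1"
      unfolding toeplitz_form_def by (simp add: one_pCons coeff_pCons m_0 sum.atMost_shift)
    moreover have "B r r = B (smult c 1) (smult c 1)" by (simp add: c)
    ultimately have "B r r = c * cnj c" by (simp only: B_linear) simp
    then show False using r c by simp
  qed
  then obtain w where "poly r w = 0"
    using fundamental_theorem_of_algebra[of r] by (auto simp: constant_degree)
  then obtain r' where r': "r = [:- w, 1:] * r'" by (auto simp: poly_eq_0_iff_dvd)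
  then have "r' \<noteq> 0" using r(1) by auto
  then have deg: "degree r = Suc (degree r')" unfolding r' by (subst degree_mult_eq) auto
  then have nz: "B r' r' \<noteq> 0" and deg': "degree r' < N"
    using min[of r'] \<open>r' \<noteq> 0\<close> r(2) by (auto simp: null_def)
  have r_eq: "r = pCons 0 r' - smult w r'" by (simp add: r')
  \<comment> \<open>Orthogonality of the null vector \<open>r\<close> to \<open>z r'\<close> and to
    \<open>r'\<close> gives \<open>A = cnj w * E\<close> and \<open>E = w * A\<close>, whence
    \<open>A = w * cnj w * A\<close>.\<close>
  define A E where "A = B r' r'" and "E = B (pCons 0 r') r'"
  have "A - cnj w * E = 0"
    using B_null[OF r(3), of "pCons 0 r'"] B_shift[OF deg' deg']
    by (simp add: r_eq B_linear A_def E_def)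
  moreover have "cnj E - cnj w * A = 0"
    using B_null[OF r(3), of r'] B_hermitian[of r' "pCons 0 r'"]
    by (simp add: r_eq B_linear A_def E_def)
  then have "cnj (cnj E) = cnj (cnj w * A)" by simp
  moreover have "cnj A = A" using B_hermitian[of r' r'] by (simp add: A_def)
  ultimately have "A = w * cnj w * A" by simp
  moreover have "A \<noteq> 0" using nz by (simp add: A_def)
  ultimately have "w * cnj w = 1" by simp
  then have w: "norm w = 1" by (rule norm_eq_1_if_mult_cnj)
  \<comment> \<open>Shifting \<open>B s r'\<close> to \<open>B (z s) (z r')\<close> and using
    \<open>w * cnj w = 1\<close> turns the left side into a multiple of
    \<open>B (z s) r\<close>.\<close>
  have "B ([:- w, 1:] * s) r' = 0" if "degree s < N" for s
  proof -
    have "B ([:- w, 1:] * s) r' = B (pCons 0 s) r' - w * B s r'"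
      by (simp add: B_linear)
    also have "\<dots> = w * (cnj w * B (pCons 0 s) r' - B (pCons 0 s) (pCons 0 r'))"
      using \<open>w * cnj w = 1\<close> B_shift[OF that deg'] by (simp add: algebra_simps)
    also have "\<dots> = - w * B (pCons 0 s) r"
      by (simp add: r_eq B_linear algebra_simps)
    finally show ?thesis using B_null[OF r(3)] by simp
  qed
  then have "\<exists>t>0. \<forall>s. degree s \<le> N \<longrightarrow> t * (norm (poly s w))\<^sup>2 \<le> Re (B s s)"
    by (rule evaluation_dominated) (use deg' nz in auto)
  then show ?thesis using w by (intro bexI[of _ w]) auto
qed

lemma evaluation_dominated_exists:
  "\<exists>w\<in>sphere 0 1. \<exists>t>0. \<forall>s. degree s \<le> N \<longrightarrow> t * (norm (poly s w))\<^sup>2 \<le> Re (B s s)"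
proof -
  obtain s where s: "\<forall>i\<ge>N. coeff s i = 0"
    and orth: "\<And>s'. \<forall>i\<ge>N. coeff s' i = 0 \<Longrightarrow> B ([:- 1, 1:] * s') (1 - [:- 1, 1:] * s) = 0"
    using projection_exists[of N "[:- 1, 1:]" 1] by blast
  define r where "r = 1 - [:- 1, 1:] * s"
  \<comment> \<open>This keeps \<open>r\<close> nonzero, so if \<open>r\<close> is null the
    degenerate case takes over.\<close>
  have "poly r 1 = 1" by (simp add: r_def)
  then have "r \<noteq> 0" by auto
  have "degree r \<le> N"
  proof (rule degree_le, intro allI impI)
    fix i assume "N < i"
    then obtain j where "i = Suc j" "N \<le> j" by (cases i) auto
    then show "coeff r i = 0" using s by (simp add: r_def)
  qed
  show ?thesis
  proof (cases "B r r = 0")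
    case True
    then show ?thesis
      using evaluation_dominated_degenerate \<open>r \<noteq> 0\<close> \<open>degree r \<le> N\<close> by blast
  next
    case False
    have "B ([:- 1, 1:] * s') r = 0" if "degree s' < N" for s'
      using orth[of s'] that coeff_eq_0[of s'] by (simp only: r_def) auto
    then have "\<exists>t>0. \<forall>s. degree s \<le> N \<longrightarrow> t * (norm (poly s 1))\<^sup>2 \<le> Re (B s s)"
      using \<open>degree r \<le> N\<close> False by (rule evaluation_dominated)
    then show ?thesis by (intro bexI[of _ 1]) auto
  qed
qed

end

subsection \<open>States\<close>

text \<open>The Laurent coefficients of the hermitian square \<open>r cnj r\<close> on the circle,
  with \<open>r\<close> cut off beyond degree \<open>N\<close>.\<close>

definition autocorr :: "nat \<Rightarrow> complex poly \<Rightarrow> int \<Rightarrow> complex" where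
  "autocorr N r = (\<lambda>k. \<Sum>i\<le>N. \<Sum>j\<le>N.
     if k = int i - int j then coeff r i * cnj (coeff r j) else 0)"

lemma autocorr_fejer_riesz: "autocorr N r \<in> fejer_riesz (Suc N)"
proof -
  have "autocorr N r k = 0" if "\<not> (- int (Suc N) < k \<and> k < int (Suc N))" for k
    unfolding autocorr_def by (intro sum.neutral ballI) (use that in auto)
  then show ?thesis by (auto simp: fejer_riesz_def)
qed

text \<open>The weight \<open>f\<close> is arbitrary so as to cover both the powers of a point of
  the circle and the moments of a state.\<close>

lemma sum_autocorr:
  "(\<Sum>k\<in>{- int (Suc N)<..<int (Suc N)}. autocorr N r k * f k) = toeplitz_form N f r r"
proof -
  have "(\<Sum>k\<in>{- int (Suc N)<..<int (Suc N)}. autocorr N r k * f k)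
      = (\<Sum>k\<in>{- int (Suc N)<..<int (Suc N)}. \<Sum>i\<le>N. \<Sum>j\<le>N.
          if k = int i - int j then coeff r i * cnj (coeff r j) * f k else 0)"
    unfolding autocorr_def sum_distrib_right by (intro sum.cong refl) auto
  also have "\<dots> = (\<Sum>i\<le>N. \<Sum>j\<le>N. \<Sum>k\<in>{- int (Suc N)<..<int (Suc N)}.
          if k = int i - int j then coeff r i * cnj (coeff r j) * f k else 0)"
    by (subst sum.swap, rule sum.cong[OF refl], rule sum.swap)
  also have "\<dots> = toeplitz_form N f r r"
    unfolding toeplitz_form_def by (intro sum.cong refl) (auto simp: sum.delta)
  finally show ?thesis .
qed

lemma toeplitz_form_powi:
  assumes "\<zeta> \<in> sphere 0 1"
  shows "toeplitz_form N (\<lambda>k. \<zeta> powi k) s r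
           = (\<Sum>i\<le>N. coeff s i * \<zeta> ^ i) * cnj (\<Sum>i\<le>N. coeff r i * \<zeta> ^ i)"
proof -
  have "\<zeta> powi (int i - int j) = \<zeta> ^ i * cnj \<zeta> ^ j" for i j
    using circle_mult_cnj(3,4)[OF assms]
    by (simp add: power_int_diff divide_inverse flip: power_inverse)
  then show ?thesis
    unfolding toeplitz_form_def cnj_sum sum_product by (intro sum.cong refl) simp
qed

text \<open>The truncated sum in place of \<open>poly r \<zeta>\<close> avoids a degree bound, so
  that positivity of the form holds for every \<open>r\<close>, as \<open>psd_toeplitz\<close>
  demands.\<close>

lemma laurent_autocorr_sum:
  assumes "\<zeta> \<in> sphere 0 1"
  shows "laurent (Suc N) (autocorr N r) \<zeta> = of_real ((norm (\<Sum>i\<le>N. coeff r i * \<zeta> ^ i))\<^sup>2)"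
  unfolding laurent_def sum_autocorr toeplitz_form_powi[OF assms] complex_norm_square ..

lemma laurent_autocorr:
  assumes "\<zeta> \<in> sphere 0 1" "degree r \<le> N"
  shows "laurent (Suc N) (autocorr N r) \<zeta> = of_real ((norm (poly r \<zeta>))\<^sup>2)"
  unfolding laurent_autocorr_sum[OF assms(1)] poly_sum_le_degree[OF assms(2)] ..

lemma autocorr_fr_cone: "autocorr N r \<in> fr_cone (Suc N)"
  unfolding fr_cone_def using autocorr_fejer_riesz laurent_autocorr_sum
  by (auto simp del: of_real_power)

lemma fejer_riesz_factorization:
  assumes "a \<in> fr_cone (Suc N)"
  obtains r where "degree r \<le> N" "a = autocorr N r"
proof -
  let ?num = "laurent_numerator (Suc N)"
  obtain r where r: "degree r \<le> N"
    "\<And>\<zeta>. \<zeta> \<in> sphere 0 1 \<Longrightarrow> cnj \<zeta> ^ N * poly (?num a) \<zeta> = of_real ((norm (poly r \<zeta>))\<^sup>2)"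
    using assms pos_poly_eq_square[of "?num a" N] by (auto simp: fr_cone_iff)
  have "?num a = ?num (autocorr N r)"
  proof (rule poly_eqI_circle)
    fix \<zeta> :: complex assume \<zeta>: "\<zeta> \<in> sphere 0 1"
    have "cnj \<zeta> ^ N * poly (?num a) \<zeta> = cnj \<zeta> ^ N * poly (?num (autocorr N r)) \<zeta>"
      using r(2)[OF \<zeta>] laurent_autocorr[OF \<zeta> r(1)] laurent_eq_poly[OF \<zeta>] by simp
    then show "poly (?num a) \<zeta> = poly (?num (autocorr N r)) \<zeta>"
      using circle_mult_cnj(3)[OF \<zeta>] by simp
  qed
  then have "a = autocorr N r"
    using assms autocorr_fejer_riesz by (auto simp: fr_cone_iff intro: laurent_numerator_inj)
  then show thesis using r(1) that by blast
qed

text \<open>The trigonometric moments of a functional. They are meaningful only for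
  \<open>z^k\<close> in the system, and \<open>toeplitz_form N\<close> uses just the indices from
  \<open>- N\<close> to \<open>N\<close>.\<close>

definition moment :: "((int \<Rightarrow> complex) \<Rightarrow> complex) \<Rightarrow> int \<Rightarrow> complex" where
  "moment \<phi> k = \<phi> (\<lambda>j. if j = k then 1 else 0)"

lemma state_eq_sum_moment:
  assumes \<phi>: "\<phi> \<in> fr_states n" and a: "a \<in> fejer_riesz n"
  shows "\<phi> a = (\<Sum>k\<in>{- int n<..<int n}. a k * moment \<phi> k)"
proof -
  have add: "\<phi> (\<lambda>k. b k + c k) = \<phi> b + \<phi> c" if "b \<in> fejer_riesz n" "c \<in> fejer_riesz n" for b c
    using \<phi> that by (simp add: fr_states_def)
  have scale: "\<phi> (\<lambda>k. x * b k) = x * \<phi> b" if "b \<in> fejer_riesz n" for b x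
    using \<phi> that by (simp add: fr_states_def)
  have "\<phi> (\<lambda>j. if j \<in> K then a j else 0) = (\<Sum>k\<in>K. a k * moment \<phi> k)"
    if "finite K" "K \<subseteq> {- int n<..<int n}" for K
    using that
  proof (induction K rule: finite_induct)
    case empty
    then show ?case using scale[OF a, of 0] by simp
  next
    case (insert k K)
    let ?\<delta> = "\<lambda>j. if j = k then (1::complex) else 0"
    have "?\<delta> \<in> fejer_riesz n" using insert.prems by (simp add: fejer_riesz_def)
    moreover have "(\<lambda>j. if j \<in> insert k K then a j else 0)
        = (\<lambda>j. a k * ?\<delta> j + (if j \<in> K then a j else 0))"
      using insert.hyps by auto
    moreover have "(\<lambda>j. a k * ?\<delta> j) \<in> fejer_riesz n" "(\<lambda>j. if j \<in> K then a j else 0) \<in> fejer_riesz n"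
      using a insert.prems by (auto simp: fejer_riesz_def)
    ultimately show ?case
      using insert scale[of ?\<delta> "a k"] by (simp add: add moment_def)
  qed
  from this[of "{- int n<..<int n}"]
  have "\<phi> (\<lambda>j. if j \<in> {- int n<..<int n} then a j else 0)
      = (\<Sum>k\<in>{- int n<..<int n}. a k * moment \<phi> k)" by simp
  moreover have "(\<lambda>j. if j \<in> {- int n<..<int n} then a j else 0) = a"
    using a by (force simp: fejer_riesz_def)
  ultimately show ?thesis by simp
qed

lemma state_autocorr:
  "\<phi> \<in> fr_states (Suc N) \<Longrightarrow> \<phi> (autocorr N r) = toeplitz_form N (moment \<phi>) r r"
  using state_eq_sum_moment[OF _ autocorr_fejer_riesz] by (simp only: sum_autocorr)

lemma psd_toeplitz_state:
  assumes "\<phi> \<in> fr_states (Suc N)"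
  shows "psd_toeplitz N (moment \<phi>)"
proof
  show "toeplitz_form N (moment \<phi>) r r \<in> \<real>\<^sub>\<ge>\<^sub>0" for r
    using assms autocorr_fr_cone by (simp add: fr_states_def flip: state_autocorr[OF assms])
  show "moment \<phi> 0 = 1"
    using assms by (simp add: fr_states_def moment_def fr_unit_def)
qed

section \<open>Evaluations at points of the circle, and pure states\<close>

lemma fr_unit_fejer_riesz: "fr_unit \<in> fejer_riesz (Suc N)"
  by (simp add: fejer_riesz_def fr_unit_def)

lemma laurent_fr_unit: "laurent (Suc N) fr_unit w = 1"
proof -
  have "laurent (Suc N) fr_unit w = (\<Sum>k\<in>{- int (Suc N)<..<int (Suc N)}. if k = 0 then 1 else 0)"
    unfolding laurent_def by (intro sum.cong refl) (simp add: fr_unit_def)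
  then show ?thesis by simp
qed

abbreviation (input) evaluation :: "nat \<Rightarrow> complex \<Rightarrow> (int \<Rightarrow> complex) \<Rightarrow> complex" where
  "evaluation n w \<equiv> \<lambda>a\<in>fejer_riesz n. laurent n a w"

lemma laurent_add: "laurent n (\<lambda>k. a k + b k) w = laurent n a w + laurent n b w"
  by (simp add: laurent_def sum.distrib algebra_simps)

lemma laurent_scale: "laurent n (\<lambda>k. c * a k) w = c * laurent n a w"
  by (simp add: laurent_def sum_distrib_left mult.assoc)

lemma evaluation_state:
  assumes "w \<in> sphere 0 1"
  shows "evaluation (Suc N) w \<in> fr_states (Suc N)"
  using assms
  by (auto simp: fr_states_def fejer_riesz_closed laurent_add laurent_scale fr_unit_fejer_riesz
      laurent_fr_unit fr_cone_def simp del: mem_sphere)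

lemma state_eqI:
  assumes "\<phi> \<in> fr_states n" "\<psi> \<in> fr_states n"
    and "\<And>k. - int n < k \<Longrightarrow> k < int n \<Longrightarrow> moment \<phi> k = moment \<psi> k"
  shows "\<phi> = \<psi>"
proof (rule extensionalityI)
  show "\<phi> \<in> extensional (fejer_riesz n)" "\<psi> \<in> extensional (fejer_riesz n)"
    using assms by (simp_all add: fr_states_def)
  fix a assume "a \<in> fejer_riesz n"
  then show "\<phi> a = \<psi> a"
    using assms by (simp add: state_eq_sum_moment)
qed

lemma moment_evaluation:
  assumes "- int n < k" "k < int n"
  shows "moment (evaluation n w) k = w powi k"
proof -
  have "laurent n (\<lambda>j. if j = k then 1 else 0) w
      = (\<Sum>j\<in>{- int n<..<int n}. if j = k then w powi k else 0)"
    unfolding laurent_def by (intro sum.cong refl) simp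
  then show ?thesis using assms by (simp add: moment_def fejer_riesz_def)
qed

text \<open>\<open>\<psi>\<close> vanishes on \<open>\<bar>1 - (\<zeta>/w)^k\<bar>\<^sup>2\<close>, so Cauchy-Schwarz makes \<open>1 - (\<zeta>/w)^k\<close> orthogonal to \<open>1\<close>.\<close>

lemma state_dominated_by_evaluation:
  assumes \<psi>: "\<psi> \<in> fr_states (Suc N)" and w: "w \<in> sphere 0 1"
    and null: "\<And>a. a \<in> fr_cone (Suc N) \<Longrightarrow> laurent (Suc N) a w = 0 \<Longrightarrow> \<psi> a = 0"
  shows "\<psi> = evaluation (Suc N) w"
proof (rule state_eqI[OF \<psi> evaluation_state[OF w]])
  interpret psd_toeplitz N "moment \<psi>" using \<psi> by (rule psd_toeplitz_state)
  have B_monom: "B (monom 1 i) (monom 1 j) = moment \<psi> (int i - int j)" if "i \<le> N" "j \<le> N" for i j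
  proof -
    have "B (monom 1 i) (monom 1 j)
        = (\<Sum>i'\<le>N. \<Sum>j'\<le>N. if i' = i then (if j' = j then moment \<psi> (int i - int j) else 0) else 0)"
      unfolding toeplitz_form_def by (intro sum.cong refl) auto
    also have "\<dots> = (\<Sum>i'\<le>N. if i' = i then moment \<psi> (int i - int j) else 0)"
      by (intro sum.cong refl) (use that in auto)
    finally show ?thesis using that by simp
  qed
  \<comment> \<open>Pairing 1 with \<open>z^k\<close> yields the moment at \<open>- k\<close>, so
    negative indices come first; hermitian symmetry supplies the others.\<close>
  have neg: "moment \<psi> (- int k) = w powi (- int k)" if "k \<le> N" for k
  proof -
    define r where "r = monom 1 0 - smult (cnj w ^ k) (monom 1 k)"
    have "degree r \<le> N"
      using that unfolding r_def by (intro degree_diff_le order.trans[OF degree_smult_le])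
        (auto simp: degree_monom_eq)
    moreover have "poly r w = 0"
      using circle_mult_cnj[OF w] by (simp add: r_def poly_monom flip: power_mult_distrib)
    ultimately have "\<psi> (autocorr N r) = 0"
      by (intro null autocorr_fr_cone) (simp add: laurent_autocorr[OF w])
    then have "B (monom 1 0) r = 0"
      by (simp add: B_null state_autocorr[OF \<psi>])
    then have "1 = w ^ k * moment \<psi> (- int k)"
      using that B_monom[of 0 0] B_monom[of 0 k] by (simp only: r_def B_linear) (simp add: m_0)
    then show ?thesis
      using circle_mult_cnj(3)[OF w] by (simp add: power_int_minus field_simps)
  qed
  have pos: "moment \<psi> (int k) = w powi int k" if "k \<le> N" for k
  proof -
    have "moment \<psi> (int k) = cnj (moment \<psi> (- int k))"
      using B_hermitian[of "monom 1 k" "monom 1 0"] that B_monom[of 0 k] B_monom[of k 0] by simp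
    then show ?thesis
      using neg[OF that] circle_mult_cnj(4)[OF w]
      by (simp add: power_int_minus power_inverse[symmetric])
  qed
  fix k assume k: "- int (Suc N) < k" "k < int (Suc N)"
  then show "moment \<psi> k = moment (evaluation (Suc N) w) k"
    using pos[of "nat k"] neg[of "nat (- k)"] unfolding moment_evaluation[OF k]
    by (cases "k \<ge> 0") auto
qed

text \<open>A convex combination of nonnegative numbers with positive weights vanishes only if both
  do, so each component is null on the positive elements that vanish at \<open>w\<close>.\<close>

lemma evaluation_pure:
  assumes w: "w \<in> sphere 0 1"
  shows "evaluation (Suc N) w \<in> fr_pure_states (Suc N)"
  unfolding fr_pure_states_def
proof (intro CollectI conjI ballI allI impI evaluation_state[OF w])
  fix \<psi> \<theta> and t :: real
  assume st: "\<psi> \<in> fr_states (Suc N)" "\<theta> \<in> fr_states (Suc N)"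
    and h: "0 < t \<and> t < 1 \<and> evaluation (Suc N) w
      = (\<lambda>a\<in>fejer_riesz (Suc N). of_real (1 - t) * \<psi> a + of_real t * \<theta> a)"
  have both: "\<psi> a = 0 \<and> \<theta> a = 0" if a: "a \<in> fr_cone (Suc N)" "laurent (Suc N) a w = 0" for a
  proof -
    have "a \<in> fejer_riesz (Suc N)" using a(1) by (simp add: fr_cone_def)
    then have sum0: "of_real (1 - t) * \<psi> a + of_real t * \<theta> a = 0"
      using a(2) fun_cong[OF conjunct2[OF conjunct2[OF h]], of a] by simp
    have "\<psi> a \<in> \<real>\<^sub>\<ge>\<^sub>0" "\<theta> a \<in> \<real>\<^sub>\<ge>\<^sub>0"
      using st a(1) by (simp_all add: fr_states_def)
    then obtain x y where xy: "\<psi> a = of_real x" "\<theta> a = of_real y" "x \<ge> 0" "y \<ge> 0"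
      by (elim nonneg_Reals_cases) blast
    have "of_real ((1 - t) * x + t * y) = (0::complex)"
      using sum0 by (simp add: xy)
    then have "(1 - t) * x + t * y = 0" by (simp only: of_real_eq_0_iff)
    then have "(1 - t) * x = 0" "t * y = 0"
      using xy h by (auto simp: add_nonneg_eq_0_iff)
    then show ?thesis using xy h by simp
  qed
  then show "\<psi> = evaluation (Suc N) w" "\<theta> = evaluation (Suc N) w"
    by (auto intro!: state_dominated_by_evaluation st w)
qed

text \<open>The form dominates a multiple \<open>t\<close> of the evaluation at some
  \<open>w\<close>. By Fejer-Riesz so does \<open>\<phi>\<close> on the cone; the renormalised
  remainder is a state \<open>\<psi>\<close>, and purity applies to the resulting convex
  combination.\<close>

lemma pure_state_is_evaluation:
  assumes "\<phi> \<in> fr_pure_states (Suc N)"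
  shows "\<exists>w\<in>sphere 0 1. \<phi> = evaluation (Suc N) w"
proof -
  have \<phi>: "\<phi> \<in> fr_states (Suc N)" using assms by (simp add: fr_pure_states_def)
  interpret psd_toeplitz N "moment \<phi>" using \<phi> by (rule psd_toeplitz_state)
  obtain w t0 where w: "w \<in> sphere 0 1" and "t0 > 0"
    and dom0: "\<And>s. degree s \<le> N \<Longrightarrow> t0 * (norm (poly s w))\<^sup>2 \<le> Re (B s s)"
    using evaluation_dominated_exists by blast
  \<comment> \<open>The cap at \<open>1 / 2\<close> keeps \<open>1 - t\<close> positive for the
    renormalisation.\<close>
  define t where "t = min t0 (1 / 2)"
  have t: "0 < t" "t < 1" using \<open>t0 > 0\<close> by (auto simp: t_def)
  let ?ev = "evaluation (Suc N) w"
  have dom: "\<phi> a - of_real t * ?ev a \<in> \<real>\<^sub>\<ge>\<^sub>0" if a: "a \<in> fr_cone (Suc N)" for a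
  proof -
    obtain r where r: "degree r \<le> N" "a = autocorr N r"
      using fejer_riesz_factorization[OF a] .
    have "t * (norm (poly r w))\<^sup>2 \<le> t0 * (norm (poly r w))\<^sup>2"
      by (intro mult_right_mono) (auto simp: t_def)
    then have "t * (norm (poly r w))\<^sup>2 \<le> Re (B r r)"
      using dom0[OF r(1)] by simp
    moreover have "\<phi> a = B r r" "?ev a = of_real ((norm (poly r w))\<^sup>2)"
      using r laurent_autocorr[OF w r(1)] autocorr_fejer_riesz
      by (simp_all add: state_autocorr[OF \<phi>])
    ultimately show ?thesis
      using psd[of r] by (simp add: complex_nonneg_Reals_iff flip: of_real_power)
  qed
  define \<psi> where "\<psi> = (\<lambda>a\<in>fejer_riesz (Suc N). (\<phi> a - of_real t * ?ev a) / of_real (1 - t))"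
  have "1 - complex_of_real t \<noteq> 0"
    using t by (metis less_irrefl of_real_1 of_real_eq_iff right_minus_eq)
  have "\<psi> a \<in> \<real>\<^sub>\<ge>\<^sub>0" if "a \<in> fr_cone (Suc N)" for a
  proof -
    have "\<psi> a = (\<phi> a - of_real t * ?ev a) / of_real (1 - t)"
      using that by (simp add: \<psi>_def fr_cone_def)
    moreover have "complex_of_real (1 - t) \<in> \<real>\<^sub>\<ge>\<^sub>0"
      using t by (simp add: complex_nonneg_Reals_iff)
    ultimately show ?thesis using dom[OF that] by (simp only: nonneg_Reals_divide_I)
  qed
  moreover have "\<psi> (\<lambda>k. a k + b k) = \<psi> a + \<psi> b"
    if "a \<in> fejer_riesz (Suc N)" "b \<in> fejer_riesz (Suc N)" for a b
    using that \<phi> by (simp add: \<psi>_def fejer_riesz_closed laurent_add fr_states_def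
        add_divide_distrib diff_divide_distrib algebra_simps)
  moreover have "\<psi> (\<lambda>k. c * a k) = c * \<psi> a" if "a \<in> fejer_riesz (Suc N)" for a c
    using that \<phi> by (simp add: \<psi>_def fejer_riesz_closed laurent_scale fr_states_def
        diff_divide_distrib algebra_simps)
  moreover have "\<psi> fr_unit = 1"
    using \<phi> \<open>1 - complex_of_real t \<noteq> 0\<close>
    by (simp add: \<psi>_def fr_unit_fejer_riesz laurent_fr_unit fr_states_def)
  moreover have "\<psi> \<in> extensional (fejer_riesz (Suc N))" by (simp add: \<psi>_def)
  ultimately have \<psi>: "\<psi> \<in> fr_states (Suc N)" by (simp add: fr_states_def)
  have "\<phi> = (\<lambda>a\<in>fejer_riesz (Suc N). of_real (1 - t) * \<psi> a + of_real t * ?ev a)"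
  proof (rule extensionalityI)
    show "\<phi> \<in> extensional (fejer_riesz (Suc N))" using \<phi> by (simp add: fr_states_def)
  qed (use \<open>1 - complex_of_real t \<noteq> 0\<close> in \<open>auto simp: \<psi>_def\<close>)
  then have "?ev = \<phi>"
    using assms \<psi> evaluation_state[OF w] t unfolding fr_pure_states_def by blast
  then show ?thesis using w by auto
qed

theorem proposition4p5:
  fixes n :: nat
  assumes "0 < n"
  shows "{a. spans_extreme_ray n a} = {a \<in> fr_cone n. laurent_zeroes n a \<subseteq> sphere 0 1} \<and>
         fr_pure_states n = (\<lambda>w. \<lambda>a\<in>fejer_riesz n. laurent n a w) ` sphere 0 1"
proof -
  obtain N where n: "n = Suc N" using assms by (cases n) auto
  have "{a. spans_extreme_ray n a} = {a \<in> fr_cone n. laurent_zeroes n a \<subseteq> sphere 0 1}"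
    unfolding n by (simp add: spans_extreme_ray_iff)
  moreover have "fr_pure_states n = (\<lambda>w. \<lambda>a\<in>fejer_riesz n. laurent n a w) ` sphere 0 1"
    unfolding n using evaluation_pure[of _ N] pure_state_is_evaluation[of _ N] by blast
  ultimately show ?thesis ..
qed

end
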